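(* Let $\mathcal{M}_{\mathcal{I}}$ be a factor system which satisfies $a_i\asymp b_i\iff a_i\overset{p}{\mapsto}b_i\iff a_i=b_i$ for all $i\in\mathcal{I}$ and $a_i,b_i\in\mathcal{M}_i$, and let the PER-set $\mathcal{M}$ be a maximal target for $\mathcal{M}_{\mathcal{I}}$. 1. Then $\mathcal{M}_{\mathcal{I}}\simeq\mathcal{AP}(\mathcal{M})$ (as factor systems); in particular $\mathcal{M}_{\mathcal{I}}\simeq\mathcal{AP}(\mathcal{EL}(\mathcal{M}_{\mathcal{I}}))$. 2. If $\mathcal{M}$ is extensional and complete, then $\mathcal{M}$ is a limit of $\mathcal{M}_{\mathcal{I}}$ and $\mathcal{M}\simeq\mathcal{EL}(\mathcal{M}_{\mathcal{I}})$ (as PER-sets); in particular $\mathcal{M}\simeq\mathcal{EL}(\mathcal{AP}(\mathcal{M}))$.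
   Context: Index sets $\mathcal{I},\mathcal{J},\dots$ are non-empty directed preordered sets (products carry the product order). For each index set $\mathcal{I}$ (including products) a set $\mathfrak{D}(\mathcal{I})\subseteq\mathcal{P}(\mathcal{I})$ is fixed. Standing assumptions: $\mathfrak{D}(\mathcal{I})$ is a proper filter of subsets of $\mathcal{I}$, all of whose members are cofinal, and it contains all non-empty up-sets; and if $\mathcal{H}\in\mathfrak{D}(\mathcal{I}\times\mathcal{J})$ and $\mathcal{I}'\in\mathfrak{D}(\mathcal{I})$, then $\{j\in\mathcal{J}\mid\exists i\in\mathcal{I}'\ (i,j)\in\mathcal{H}\}\in\mathfrak{D}(\mathcal{J})$. Factor systems. A system $(\mathcal{M}_{\mathcal{I}},\overset{p}{\mapsto})$ is a family of finite sets $(\mathcal{M}_i)_{i\in\mathcal{I}}$ (regarded as disjoint) with relations $\overset{p}{\mapsto}\subseteq\mathcal{M}_{i'}\times\mathcal{M}_i$ for $i'\ge i$, reflexive for $i=i'$. Elements $a_i\in\mathcal{M}_i$, $b_j\in\mathcal{M}_j$ are consistent, $a_i\asymp b_j$, iff there are $i'\ge i,j$ and $a_{i'}\in\mathcal{M}_{i'}$ with $a_{i'}\overset{p}{\mapsto}a_i$ and $a_{i'}\overset{p}{\mapsto}b_j$. A prefactor system is a system with $a_{i'}\asymp a_i\iff a_{i'}\overset{p}{\mapsto}a_i$ for all $i\le i'$. A factor system is a prefactor system with $\asymp$-preserving maps $emb_i^{i'}:\mathcal{M}_i\to\mathcal{M}_{i'}$ and $proj_i^{i'}:\mathcal{M}_{i'}\to\mathcal{M}_i$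 ($i\le i'$) such that, for $i\le i'\le i''$: $emb_i^i(a_i)\asymp a_i\asymp proj_i^i(a_i)$; $emb_{i'}^{i''}(emb_i^{i'}(a_i))\asymp emb_i^{i''}(a_i)$; $proj_i^{i'}(proj_{i'}^{i''}(a_{i''}))\asymp proj_i^{i''}(a_{i''})$; $proj_i^{i'}(emb_i^{i'}(a_i))\asymp a_i$; $a_{i'}\overset{p}{\mapsto}a_i\Rightarrow emb_{i'}^{i''}(a_{i'})\overset{p}{\mapsto}a_i$; $a_{i''}\overset{p}{\mapsto}a_i\Rightarrow proj_{i'}^{i''}(a_{i''})\overset{p}{\mapsto}a_i$. A homomorphism of factor systems $\mathcal{M}_{\mathcal{I}}\to\mathcal{N}_{\mathcal{J}}$ is a monotone map $\Phi_0:\mathcal{I}\to\mathcal{J}$ with maps $\Phi^i:\mathcal{M}_i\to\mathcal{N}_{\Phi_0(i)}$ preserving $\overset{p}{\mapsto}$ and commuting (with equality) with all $emb$ and $proj$; an isomorphism ($\simeq$) is one with a componentwise inverse homomorphism. Targets. A target $(\mathcal{M},\overset{p}{\longmapsto},Emb,Proj)$ for a factor system is a set $\mathcal{M}$ with relations $\overset{p}{\longmapsto}\subseteq\mathcal{M}\times\mathcal{M}_i$ and maps $Emb_i:\mathcal{M}_i\to\mathcal{M}$, $Proj_i:\mathcal{M}\to\mathcal{M}_i$ such that $\{i\in\mathcal{I}\mid\exists a_i\in\mathcal{M}_i\ a\overset{p}{\longmapsto}a_i\}\in\mathfrak{D}(\mathcal{I})$ for all $a\in\mathcal{M}$; and for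 $i\le i'$: $a\overset{p}{\longmapsto}a_{i'}$, $a\overset{p}{\longmapsto}a_i$ imply $a_{i'}\overset{p}{\mapsto}a_i$; $a_i\asymp b_i$ implies $Emb_i(a_i)=Emb_i(b_i)$; $Emb_{i'}(emb_i^{i'}(a_i))=Emb_i(a_i)$; $a_{i'}\overset{p}{\mapsto}a_i$ implies $Emb_{i'}(a_{i'})\overset{p}{\longmapsto}a_i$; $proj_i^{i'}(Proj_{i'}(a))\asymp Proj_i(a)$; $a\overset{p}{\longmapsto}a_i$ implies $Proj_{i'}(a)\overset{p}{\mapsto}a_i$; and $Proj_i(Emb_i(a_i))\asymp a_i$. Put $Ext(a):=\{a_i\in\bigcup_i\mathcal{M}_i\mid a\overset{p}{\longmapsto}a_i\}$. A target $\mathcal{M}$ is a limit iff for every target $(\mathcal{N},\overset{q}{\longmapsto})$ for $\mathcal{M}_{\mathcal{I}}$ there is a unique map $\Phi:\mathcal{N}\to\mathcal{M}$ such that $a\overset{q}{\longmapsto}a_i$ implies $\Phi(a)\overset{p}{\longmapsto}a_i$. Dynamic elements. A consistent set is a set $\alpha\subseteq\bigcup_i\mathcal{M}_i$ with $a_{i'}\overset{p}{\mapsto}a_i$ for all $a_{i'},a_i\in\alpha$, $i'\ge i$, and $\{i\mid\alpha\cap\mathcal{M}_i\ne\emptyset\}\in\mathfrak{D}(\mathcal{I})$. Each consistent set $\alpha$ in a prefactor system lies in exactly one inclusion-maximal consistent set $\alpha^m$. $\mathcal{EL}(\mathcal{M}_{\mathcal{I}})$ is the set of all maximal consistent sets;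 it is a target (in fact a limit) for the factor system with $\alpha\overset{p}{\longmapsto}a_i:\iff a_i\in\alpha$, $Emb_i(a_i):=\{emb_i^{i'}(a_i)\mid i'\ge i\}^m$, $Proj_i(\alpha):=proj_i^{i'}(a_{i'})$ for some $i'\ge i$ with $a_{i'}\in\alpha\cap\mathcal{M}_{i'}$ (unique up to $\asymp$). A target $\mathcal{M}$ is maximal iff $Ext(a)\in\mathcal{EL}(\mathcal{M}_{\mathcal{I}})$ for all $a\in\mathcal{M}$. PER-sets. For PERs (symmetric, transitive relations) $\approx_i$ on $\mathcal{M}$ put $[i]:=\{a\mid a\approx_i a\}$, $\mathcal{I}_a:=\{i\mid a\in[i]\}$. A PER-set $(\mathcal{M},\approx_{\mathcal{I}},Pt_{\mathcal{I}})$ consists of PERs $\approx_i$ on $\mathcal{M}$ and maps $Pt_i:\mathcal{M}\to\mathcal{P}_i\subseteq\mathcal{M}$, with $pt_i:=Pt_i{\restriction}_{[i]}:[i]\to\mathcal{P}_i$ surjective, such that $\mathcal{I}_a\in\mathfrak{D}(\mathcal{I})$ for all $a$, and for $i\le i'$: $a\approx_{i'}b$, $a,b\in[i]$ imply $a\approx_i b$; $\mathcal{P}_i\subseteq\mathcal{P}_{i'}$; $a\approx_i b$ implies $a\approx_i pt_i(a)=pt_i(b)$; $a\in[i]$ implies $Pt_{i'}(a)\in[i]$; $Pt_i=Pt_i\circ Pt_{i'}$. Every target $\mathcal{M}$ for a factor system is regarded as a PER-set via: $a\approx_i b$ iff $a\overset{p}{\longmapsto}a_i$, $b\overset{p}{\longmapsto}b_i$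 for some $a_i\asymp b_i$ in $\mathcal{M}_i$; $Pt_i:=Emb_i\circ Proj_i$; $\mathcal{P}_i=\{Emb_i(a_i)\mid a_i\in\mathcal{M}_i\}$. A PER-set is extensional iff $a=b$ whenever $a\approx_i b$ for cofinally many $i\in\mathcal{I}$. It is complete iff every convergent sequence of points, i.e. every $(a^i)_{i\in\mathcal{J}}$ with $\mathcal{J}\in\mathfrak{D}(\mathcal{I})$, $a^i\in\mathcal{P}_i$ and $pt_i(a^{i'})=a^i$ for all $i'\ge i$ in $\mathcal{J}$, has a limit element, i.e. some $a\in\mathcal{M}$ with $pt_i(a)=a^i$ for all $i\in\mathcal{J}$. An isomorphism of PER-sets with the same index set $\mathcal{I}$ (with the identity on $\mathcal{I}$) is a bijection $\Phi$ with $a\approx_i b\iff\Phi(a)\approx_i\Phi(b)$ and $\Phi(Pt_i(a))=Pt_i(\Phi(a))$. Internal system. For a PER-set $\mathcal{M}$ (with finitely many $\approx_i$-classes for each $i$), $\mathcal{AP}(\mathcal{M})$ is the factor system $((\mathcal{P}_i)_{i\in\mathcal{I}},\overset{p}{\mapsto})$ with $a_{i'}\overset{p}{\mapsto}a_i:\iff a_{i'}\approx_i a_i$, embeddings the inclusions $\mathcal{P}_i\hookrightarrow\mathcal{P}_{i'}$, and projections $Pt_i{\restriction}_{\mathcal{P}_{i'}}$. *)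

theory Defs
  imports Complex_Main "HOL-Library.FuncSet" "HOL-Library.Product_Order"
begin

text \<open>
  An index set is a type of class \<open>preorder\<close> (hence non-empty); products of index sets carry
  the product order of \<open>Product_Order\<close>. The family \<open>\<DD>(\<I>)\<close> of subsets of \<open>\<I>\<close> is
  rendered as a library filter \<open>D\<close>, where \<open>A \<in> \<DD>(\<I>)\<close> reads \<open>\<forall>\<^sub>F i in D. i \<in> A\<close>.
\<close>

definition cofinal :: "'i::preorder set \<Rightarrow> bool" where
  "cofinal A \<longleftrightarrow> (\<forall>i. \<exists>j\<in>A. i \<le> j)"

definition up_set :: "'i::preorder set \<Rightarrow> bool" where
  "up_set U \<longleftrightarrow> (\<forall>i\<in>U. \<forall>j. i \<le> j \<longrightarrow> j \<in> U)"

definition index_filter :: "'i::preorder filter \<Rightarrow> bool" where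
  "index_filter D \<longleftrightarrow>
     (\<forall>i j :: 'i. \<exists>k. i \<le> k \<and> j \<le> k) \<and>
     D \<noteq> bot \<and>
     (\<forall>A. (\<forall>\<^sub>F i in D. i \<in> A) \<longrightarrow> cofinal A) \<and>
     (\<forall>U. up_set U \<and> U \<noteq> {} \<longrightarrow> (\<forall>\<^sub>F i in D. i \<in> U))"

definition product_compatible :: "'i filter \<Rightarrow> 'j filter \<Rightarrow> ('i \<times> 'j) filter \<Rightarrow> bool" where
  "product_compatible D E DE \<longleftrightarrow>
     (\<forall>H I'. (\<forall>\<^sub>F x in DE. x \<in> H) \<and> (\<forall>\<^sub>F i in D. i \<in> I') \<longrightarrow>
        (\<forall>\<^sub>F j in E. \<exists>i\<in>I'. (i, j) \<in> H))"


section \<open>Factor systems\<close>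

text \<open>
  The sets \<open>\<M>\<^sub>i\<close> may overlap as subsets of \<open>'a\<close>. Every operation takes the indices
  of its arguments explicitly, and elements of the disjoint union are pairs \<open>(i, a)\<close>.
  \<open>Pred S i' i a' a\<close> is the relation between \<open>a' \<in> \<M>\<^sub>i\<^sub>'\<close> and \<open>a \<in> \<M>\<^sub>i\<close>, \<open>emb S i i'\<close>
  maps \<open>\<M>\<^sub>i\<close> to \<open>\<M>\<^sub>i\<^sub>'\<close>, and \<open>proj S i i'\<close> maps \<open>\<M>\<^sub>i\<^sub>'\<close> to \<open>\<M>\<^sub>i\<close>; all three are
  meaningful only for \<open>i \<le> i'\<close> and on elements of the carriers.
\<close>

record ('i, 'a) fsystem =
  Lev :: "'i \<Rightarrow> 'a set"
  Pred :: "'i \<Rightarrow> 'i \<Rightarrow> 'a \<Rightarrow> 'a \<Rightarrow> bool"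
  emb :: "'i \<Rightarrow> 'i \<Rightarrow> 'a \<Rightarrow> 'a"
  proj :: "'i \<Rightarrow> 'i \<Rightarrow> 'a \<Rightarrow> 'a"

definition system :: "('i::preorder, 'a) fsystem \<Rightarrow> bool" where
  "system S \<longleftrightarrow> (\<forall>i. finite (Lev S i)) \<and> (\<forall>i. \<forall>a\<in>Lev S i. Pred S i i a a)"

definition cons :: "('i::preorder, 'a) fsystem \<Rightarrow> 'i \<Rightarrow> 'i \<Rightarrow> 'a \<Rightarrow> 'a \<Rightarrow> bool" where
  "cons S i j a b \<longleftrightarrow> (\<exists>k c. i \<le> k \<and> j \<le> k \<and> c \<in> Lev S k \<and> Pred S k i c a \<and> Pred S k j c b)"

definition prefactor_system :: "('i::preorder, 'a) fsystem \<Rightarrow> bool" where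
  "prefactor_system S \<longleftrightarrow> system S \<and>
     (\<forall>i i'. i \<le> i' \<longrightarrow>
        (\<forall>a'\<in>Lev S i'. \<forall>a\<in>Lev S i. cons S i' i a' a \<longleftrightarrow> Pred S i' i a' a))"

definition factor_system :: "('i::preorder, 'a) fsystem \<Rightarrow> bool" where
  "factor_system S \<longleftrightarrow> prefactor_system S \<and>
     (\<forall>i i'. i \<le> i' \<longrightarrow>
        emb S i i' \<in> Lev S i \<rightarrow> Lev S i' \<and>
        proj S i i' \<in> Lev S i' \<rightarrow> Lev S i \<and>
        (\<forall>a\<in>Lev S i. \<forall>b\<in>Lev S i.
           cons S i i a b \<longrightarrow> cons S i' i' (emb S i i' a) (emb S i i' b)) \<and>
        (\<forall>a\<in>Lev S i'. \<forall>b\<in>Lev S i'.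
           cons S i' i' a b \<longrightarrow> cons S i i (proj S i i' a) (proj S i i' b)) \<and>
        (\<forall>a\<in>Lev S i. cons S i i (proj S i i' (emb S i i' a)) a)) \<and>
     (\<forall>i. \<forall>a\<in>Lev S i. cons S i i (emb S i i a) a \<and> cons S i i a (proj S i i a)) \<and>
     (\<forall>i i' i''. i \<le> i' \<and> i' \<le> i'' \<longrightarrow>
        (\<forall>a\<in>Lev S i. cons S i'' i'' (emb S i' i'' (emb S i i' a)) (emb S i i'' a)) \<and>
        (\<forall>a\<in>Lev S i''. cons S i i (proj S i i' (proj S i' i'' a)) (proj S i i'' a)) \<and>
        (\<forall>a'\<in>Lev S i'. \<forall>a\<in>Lev S i.
           Pred S i' i a' a \<longrightarrow> Pred S i'' i (emb S i' i'' a') a) \<and>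
        (\<forall>a''\<in>Lev S i''. \<forall>a\<in>Lev S i.
           Pred S i'' i a'' a \<longrightarrow> Pred S i' i (proj S i' i'' a'') a))"

definition fs_hom ::
  "('i::preorder, 'a) fsystem \<Rightarrow> ('j::preorder, 'b) fsystem \<Rightarrow>
   ('i \<Rightarrow> 'j) \<Rightarrow> ('i \<Rightarrow> 'a \<Rightarrow> 'b) \<Rightarrow> bool" where
  "fs_hom S T f F \<longleftrightarrow>
     (\<forall>i i'. i \<le> i' \<longrightarrow> f i \<le> f i') \<and>
     (\<forall>i. F i \<in> Lev S i \<rightarrow> Lev T (f i)) \<and>
     (\<forall>i i'. i \<le> i' \<longrightarrow>
        (\<forall>a'\<in>Lev S i'. \<forall>a\<in>Lev S i.
           Pred S i' i a' a \<longrightarrow> Pred T (f i') (f i) (F i' a') (F i a)) \<and>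
        (\<forall>a\<in>Lev S i. F i' (emb S i i' a) = emb T (f i) (f i') (F i a)) \<and>
        (\<forall>a'\<in>Lev S i'. F i (proj S i i' a') = proj T (f i) (f i') (F i' a')))"

definition fs_iso :: "('i::preorder, 'a) fsystem \<Rightarrow> ('j::preorder, 'b) fsystem \<Rightarrow> bool" where
  "fs_iso S T \<longleftrightarrow> factor_system S \<and> factor_system T \<and>
     (\<exists>f F g G. fs_hom S T f F \<and> fs_hom T S g G \<and>
        (\<forall>i. g (f i) = i) \<and> (\<forall>j. f (g j) = j) \<and>
        (\<forall>i. \<forall>a\<in>Lev S i. G (f i) (F i a) = a) \<and>
        (\<forall>j. \<forall>b\<in>Lev T j. F (g j) (G j b) = b))"


section \<open>Targets and limits\<close>

record ('i, 'a, 'm) target =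
  Carr :: "'m set"
  Appr :: "'m \<Rightarrow> 'i \<Rightarrow> 'a \<Rightarrow> bool"
  Emb :: "'i \<Rightarrow> 'a \<Rightarrow> 'm"
  Proj :: "'i \<Rightarrow> 'm \<Rightarrow> 'a"

definition is_target ::
  "'i::preorder filter \<Rightarrow> ('i, 'a) fsystem \<Rightarrow> ('i, 'a, 'm) target \<Rightarrow> bool" where
  "is_target D S T \<longleftrightarrow>
     (\<forall>i. Emb T i \<in> Lev S i \<rightarrow> Carr T) \<and>
     (\<forall>i. Proj T i \<in> Carr T \<rightarrow> Lev S i) \<and>
     (\<forall>a\<in>Carr T. \<forall>\<^sub>F i in D. \<exists>x\<in>Lev S i. Appr T a i x) \<and>
     (\<forall>i. \<forall>x\<in>Lev S i. \<forall>y\<in>Lev S i. cons S i i x y \<longrightarrow> Emb T i x = Emb T i y) \<and>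
     (\<forall>i. \<forall>x\<in>Lev S i. cons S i i (Proj T i (Emb T i x)) x) \<and>
     (\<forall>i i'. i \<le> i' \<longrightarrow>
        (\<forall>a\<in>Carr T. \<forall>x'\<in>Lev S i'. \<forall>x\<in>Lev S i.
           Appr T a i' x' \<and> Appr T a i x \<longrightarrow> Pred S i' i x' x) \<and>
        (\<forall>x\<in>Lev S i. Emb T i' (emb S i i' x) = Emb T i x) \<and>
        (\<forall>x'\<in>Lev S i'. \<forall>x\<in>Lev S i.
           Pred S i' i x' x \<longrightarrow> Appr T (Emb T i' x') i x) \<and>
        (\<forall>a\<in>Carr T. cons S i i (proj S i i' (Proj T i' a)) (Proj T i a)) \<and>
        (\<forall>a\<in>Carr T. \<forall>x\<in>Lev S i. Appr T a i x \<longrightarrow> Pred S i' i (Proj T i' a) x))"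

definition Ext :: "('i, 'a) fsystem \<Rightarrow> ('i, 'a, 'm) target \<Rightarrow> 'm \<Rightarrow> ('i \<times> 'a) set" where
  "Ext S T a = {(i, x). x \<in> Lev S i \<and> Appr T a i x}"

text \<open>
  The competing targets have carriers in the type \<open>'n\<close>, which is a parameter; a statement
  about all targets leaves this type variable free.
\<close>

definition is_limit ::
  "'n itself \<Rightarrow> 'i::preorder filter \<Rightarrow> ('i, 'a) fsystem \<Rightarrow> ('i, 'a, 'm) target \<Rightarrow> bool" where
  "is_limit _ D S T \<longleftrightarrow> is_target D S T \<and>
     (\<forall>N :: ('i, 'a, 'n) target. is_target D S N \<longrightarrow>
        (\<exists>!\<Phi>. \<Phi> \<in> Carr N \<rightarrow>\<^sub>E Carr T \<and>
           (\<forall>a\<in>Carr N. \<forall>i. \<forall>x\<in>Lev S i. Appr N a i x \<longrightarrow> Appr T (\<Phi> a) i x)))"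


section \<open>Dynamic elements\<close>

definition consistent_set ::
  "'i::preorder filter \<Rightarrow> ('i, 'a) fsystem \<Rightarrow> ('i \<times> 'a) set \<Rightarrow> bool" where
  "consistent_set D S \<alpha> \<longleftrightarrow>
     \<alpha> \<subseteq> Sigma UNIV (Lev S) \<and>
     (\<forall>i i' x x'. (i', x') \<in> \<alpha> \<and> (i, x) \<in> \<alpha> \<and> i \<le> i' \<longrightarrow> Pred S i' i x' x) \<and>
     (\<forall>\<^sub>F i in D. \<exists>x. (i, x) \<in> \<alpha>)"

definition max_consistent_sets ::
  "'i::preorder filter \<Rightarrow> ('i, 'a) fsystem \<Rightarrow> ('i \<times> 'a) set set" where
  "max_consistent_sets D S =
     {\<alpha>. consistent_set D S \<alpha> \<and> (\<forall>\<beta>. consistent_set D S \<beta> \<and> \<alpha> \<subseteq> \<beta> \<longrightarrow> \<beta> = \<alpha>)}"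

definition maximalization ::
  "'i::preorder filter \<Rightarrow> ('i, 'a) fsystem \<Rightarrow> ('i \<times> 'a) set \<Rightarrow> ('i \<times> 'a) set" where
  "maximalization D S \<alpha> = (THE \<beta>. \<beta> \<in> max_consistent_sets D S \<and> \<alpha> \<subseteq> \<beta>)"

definition EL ::
  "'i::preorder filter \<Rightarrow> ('i, 'a) fsystem \<Rightarrow> ('i, 'a, ('i \<times> 'a) set) target" where
  "EL D S =
     \<lparr> Carr = max_consistent_sets D S,
       Appr = (\<lambda>\<alpha> i x. (i, x) \<in> \<alpha>),
       Emb = (\<lambda>i x. maximalization D S {(i', emb S i i' x) | i'. i \<le> i'}),
       Proj = (\<lambda>i \<alpha>. let (i', x') = (SOME y. y \<in> \<alpha> \<and> i \<le> fst y) in proj S i i' x') \<rparr>"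

definition maximal_target ::
  "'i::preorder filter \<Rightarrow> ('i, 'a) fsystem \<Rightarrow> ('i, 'a, 'm) target \<Rightarrow> bool" where
  "maximal_target D S T \<longleftrightarrow> is_target D S T \<and>
     (\<forall>a\<in>Carr T. Ext S T a \<in> Carr (EL D S))"


section \<open>PER-sets\<close>

text \<open>\<open>Pts M i\<close> is the codomain \<open>\<P>\<^sub>i\<close> of \<open>Pt M i\<close>.\<close>

record ('i, 'm) pset =
  PCarr :: "'m set"
  Per :: "'i \<Rightarrow> 'm \<Rightarrow> 'm \<Rightarrow> bool"
  Pt :: "'i \<Rightarrow> 'm \<Rightarrow> 'm"
  Pts :: "'i \<Rightarrow> 'm set"

definition Dom :: "('i, 'm) pset \<Rightarrow> 'i \<Rightarrow> 'm set" where
  "Dom M i = {a \<in> PCarr M. Per M i a a}"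

definition PER_set :: "'i::preorder filter \<Rightarrow> ('i, 'm) pset \<Rightarrow> bool" where
  "PER_set D M \<longleftrightarrow>
     (\<forall>i. symp_on (PCarr M) (Per M i) \<and> transp_on (PCarr M) (Per M i)) \<and>
     (\<forall>i. Pts M i \<subseteq> PCarr M \<and> Pt M i \<in> PCarr M \<rightarrow> Pts M i \<and> Pt M i ` Dom M i = Pts M i) \<and>
     (\<forall>a\<in>PCarr M. \<forall>\<^sub>F i in D. a \<in> Dom M i) \<and>
     (\<forall>i. \<forall>a\<in>PCarr M. \<forall>b\<in>PCarr M.
        Per M i a b \<longrightarrow> Per M i a (Pt M i a) \<and> Pt M i a = Pt M i b) \<and>
     (\<forall>i i'. i \<le> i' \<longrightarrow>
        (\<forall>a\<in>Dom M i. \<forall>b\<in>Dom M i. Per M i' a b \<longrightarrow> Per M i a b) \<and>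
        Pts M i \<subseteq> Pts M i' \<and>
        (\<forall>a\<in>Dom M i. Pt M i' a \<in> Dom M i) \<and>
        (\<forall>a\<in>PCarr M. Pt M i a = Pt M i (Pt M i' a)))"

definition pset_of_target ::
  "('i::preorder, 'a) fsystem \<Rightarrow> ('i, 'a, 'm) target \<Rightarrow> ('i, 'm) pset" where
  "pset_of_target S T =
     \<lparr> PCarr = Carr T,
       Per = (\<lambda>i a b. \<exists>x\<in>Lev S i. \<exists>y\<in>Lev S i. Appr T a i x \<and> Appr T b i y \<and> cons S i i x y),
       Pt = (\<lambda>i. Emb T i \<circ> Proj T i),
       Pts = (\<lambda>i. Emb T i ` Lev S i) \<rparr>"

definition extensional_pset :: "('i::preorder, 'm) pset \<Rightarrow> bool" where
  "extensional_pset M \<longleftrightarrow>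
     (\<forall>a\<in>PCarr M. \<forall>b\<in>PCarr M. cofinal {i. Per M i a b} \<longrightarrow> a = b)"

text \<open>
  The map \<open>pt\<^sub>i\<close> is defined on \<open>Dom M i\<close> only, so an equation \<open>pt\<^sub>i(a) = b\<close> includes
  \<open>a \<in> Dom M i\<close>.
\<close>

definition complete_pset :: "'i::preorder filter \<Rightarrow> ('i, 'm) pset \<Rightarrow> bool" where
  "complete_pset D M \<longleftrightarrow>
     (\<forall>J s. (\<forall>\<^sub>F i in D. i \<in> J) \<and> (\<forall>i\<in>J. s i \<in> Pts M i) \<and>
        (\<forall>i\<in>J. \<forall>i'\<in>J. i \<le> i' \<longrightarrow> s i' \<in> Dom M i \<and> Pt M i (s i') = s i) \<longrightarrow>
        (\<exists>a\<in>PCarr M. \<forall>i\<in>J. a \<in> Dom M i \<and> Pt M i a = s i))"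

definition pset_iso ::
  "'i::preorder filter \<Rightarrow> ('i, 'm) pset \<Rightarrow> ('i, 'n) pset \<Rightarrow> bool" where
  "pset_iso D M N \<longleftrightarrow> PER_set D M \<and> PER_set D N \<and>
     (\<exists>\<Phi>. bij_betw \<Phi> (PCarr M) (PCarr N) \<and>
        (\<forall>i. \<forall>a\<in>PCarr M. \<forall>b\<in>PCarr M. Per M i a b \<longleftrightarrow> Per N i (\<Phi> a) (\<Phi> b)) \<and>
        (\<forall>i. \<forall>a\<in>PCarr M. \<Phi> (Pt M i a) = Pt N i (\<Phi> a)))"

definition AP :: "('i, 'm) pset \<Rightarrow> ('i, 'm) fsystem" where
  "AP M =
     \<lparr> Lev = Pts M,
       Pred = (\<lambda>i' i a' a. Per M i a' a),
       emb = (\<lambda>i i' a. a),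
       proj = (\<lambda>i i'. Pt M i) \<rparr>"

end

theory Submission
  imports Defs
begin

text \<open>
  When the levels are discrete, \<open>Proj\<^sub>i\<close> is a genuine left inverse of \<open>Emb\<^sub>i\<close> and \<open>Emb\<^sub>i(x') \<longmapsto> x\<close> is
  equivalent to \<open>x' \<mapsto> x\<close>, so \<open>Emb\<close> identifies the factor system with the points of any of its targets.
  For the second part, \<open>a \<mapsto> Ext(a)\<close> is the comparison map: extensionality makes it injective, and
  a maximal consistent set \<open>\<alpha>\<close> yields the convergent sequence \<open>Emb\<^sub>i(x\<^sub>i)\<close>, \<open>x\<^sub>i \<in> \<alpha>\<close>, whose limit element
  has extension \<open>\<alpha>\<close>. The universal map sends \<open>a\<close> to the element whose extension is the unique
  maximal consistent set containing \<open>Ext(a)\<close>.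
\<close>

section \<open>Maximal consistent sets\<close>

lemma index_filter_directed:
  fixes i j :: "'i::preorder" and D :: "'i filter"
  assumes "index_filter D"
  obtains k where "i \<le> k" "j \<le> k"
  using that assms[unfolded index_filter_def, THEN conjunct1] by blast

lemma consistent_set_above:
  assumes "index_filter D" "consistent_set D S \<alpha>"
  obtains k z where "i \<le> k" "(k, z) \<in> \<alpha>"
proof -
  have "\<forall>\<^sub>F i in D. i \<in> {i. \<exists>x. (i, x) \<in> \<alpha>}"
    using assms(2) by (simp add: consistent_set_def)
  then have "cofinal {i. \<exists>x. (i, x) \<in> \<alpha>}"
    using assms(1) unfolding index_filter_def by blast
  then show thesis
    using that unfolding cofinal_def by blast
qed

lemma consistent_set_above2:
  assumes "index_filter D" "consistent_set D S \<alpha>"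
  obtains k z where "i \<le> k" "j \<le> k" "(k, z) \<in> \<alpha>"
proof -
  obtain l where l: "i \<le> l" "j \<le> l"
    using index_filter_directed[OF assms(1)] .
  obtain k z where "l \<le> k" "(k, z) \<in> \<alpha>"
    using consistent_set_above[OF assms] .
  with l show thesis
    using that order_trans by blast
qed

lemma consistent_set_Lev: "consistent_set D S \<alpha> \<Longrightarrow> (i, x) \<in> \<alpha> \<Longrightarrow> x \<in> Lev S i"
  unfolding consistent_set_def by blast

lemma consistent_set_Pred:
  "consistent_set D S \<alpha> \<Longrightarrow> (i', x') \<in> \<alpha> \<Longrightarrow> (i, x) \<in> \<alpha> \<Longrightarrow> i \<le> i' \<Longrightarrow> Pred S i' i x' x"
  unfolding consistent_set_def by blast

text \<open>
  Quantifying universally over the elements of \<open>\<alpha>\<close> above \<open>i\<close> matters here: two elements of the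
  hull have a common predecessor in \<open>\<alpha>\<close>, so they are consistent although \<open>Pred\<close> need not be
  transitive in a prefactor system.
\<close>

definition consistent_hull :: "('i::preorder, 'a) fsystem \<Rightarrow> ('i \<times> 'a) set \<Rightarrow> ('i \<times> 'a) set" where
  "consistent_hull S \<alpha> =
     {(i, x). x \<in> Lev S i \<and> (\<forall>j y. (j, y) \<in> \<alpha> \<and> i \<le> j \<longrightarrow> Pred S j i y x)}"

text \<open>Consistency of \<open>\<beta>\<close> compares each of its elements with all elements of
  \<open>\<alpha>\<close> above it. So the hull bounds every consistent superset of
  \<open>\<alpha>\<close>; once shown consistent itself, it is the unique maximal one.\<close>

lemma consistent_subset_hull:
  assumes "consistent_set D S \<beta>" "\<alpha> \<subseteq> \<beta>"
  shows "\<beta> \<subseteq> consistent_hull S \<alpha>"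
proof clarify
  fix i x assume "(i, x) \<in> \<beta>"
  then show "(i, x) \<in> consistent_hull S \<alpha>"
    using consistent_set_Lev[OF assms(1)] consistent_set_Pred[OF assms(1)] assms(2)
    unfolding consistent_hull_def by blast
qed

lemma consistent_set_hull:
  assumes D: "index_filter D" and S: "prefactor_system S" and \<alpha>: "consistent_set D S \<alpha>"
  shows "consistent_set D S (consistent_hull S \<alpha>)"
  unfolding consistent_set_def
proof (intro conjI allI impI)
  show "consistent_hull S \<alpha> \<subseteq> Sigma UNIV (Lev S)"
    by (auto simp: consistent_hull_def)
next
  fix i i' x x'
  assume A: "(i', x') \<in> consistent_hull S \<alpha> \<and> (i, x) \<in> consistent_hull S \<alpha> \<and> i \<le> i'"
  \<comment> \<open>The levels met by \<open>\<alpha>\<close> are cofinal and the order is directed,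
    so some element of \<open>\<alpha>\<close> lies above both indices. It witnesses
    \<open>cons\<close>, which the prefactor law turns into \<open>Pred\<close>.\<close>
  obtain k z where k: "i \<le> k" "i' \<le> k" "(k, z) \<in> \<alpha>"
    using consistent_set_above2[OF D \<alpha>] .
  then have "Pred S k i z x" "Pred S k i' z x'" "z \<in> Lev S k"
    using A consistent_set_Lev[OF \<alpha>] by (auto simp: consistent_hull_def)
  with k have "cons S i' i x' x"
    unfolding cons_def by blast
  then show "Pred S i' i x' x"
    using A S unfolding prefactor_system_def consistent_hull_def by blast
next
  have "\<forall>\<^sub>F i in D. \<exists>x. (i, x) \<in> \<alpha>"
    using \<alpha> unfolding consistent_set_def by blast
  then show "\<forall>\<^sub>F i in D. \<exists>x. (i, x) \<in> consistent_hull S \<alpha>"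
    using consistent_subset_hull[OF \<alpha> subset_refl] by (auto elim!: eventually_mono)
qed

lemma hull_max_consistent:
  assumes "index_filter D" "prefactor_system S" "consistent_set D S \<alpha>"
  shows "consistent_hull S \<alpha> \<in> max_consistent_sets D S"
proof -
  have "\<alpha> \<subseteq> consistent_hull S \<alpha>"
    using consistent_subset_hull[OF assms(3) subset_refl] .
  then show ?thesis
    using consistent_set_hull[OF assms] consistent_subset_hull
    unfolding max_consistent_sets_def by blast
qed

lemma max_consistent_eq_hull:
  assumes "index_filter D" "prefactor_system S" "consistent_set D S \<alpha>"
    and "\<beta> \<in> max_consistent_sets D S" "\<alpha> \<subseteq> \<beta>"
  shows "\<beta> = consistent_hull S \<alpha>"
  using assms(4) consistent_set_hull[OF assms(1-3)] consistent_subset_hull[OF _ assms(5)]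
  unfolding max_consistent_sets_def by blast

lemma maximalization_eq_hull:
  assumes "index_filter D" "prefactor_system S" "consistent_set D S \<alpha>"
  shows "maximalization D S \<alpha> = consistent_hull S \<alpha>"
  unfolding maximalization_def
proof (rule the_equality)
  show "consistent_hull S \<alpha> \<in> max_consistent_sets D S \<and> \<alpha> \<subseteq> consistent_hull S \<alpha>"
    using hull_max_consistent[OF assms] consistent_subset_hull[OF assms(3) subset_refl] by blast
qed (use max_consistent_eq_hull[OF assms] in blast)

lemma maximalization_eqI:
  assumes "index_filter D" "prefactor_system S" "consistent_set D S \<alpha>"
    and "\<beta> \<in> max_consistent_sets D S" "\<alpha> \<subseteq> \<beta>"
  shows "maximalization D S \<alpha> = \<beta>"
  using max_consistent_eq_hull[OF assms] maximalization_eq_hull[OF assms(1-3)] by simp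


section \<open>Transport of factor systems along bijections\<close>

lemma factor_systemD:
  assumes "factor_system S"
  shows "prefactor_system S"
    and "\<And>i a. a \<in> Lev S i \<Longrightarrow> cons S i i (emb S i i a) a"
    and "\<And>i a. a \<in> Lev S i \<Longrightarrow> cons S i i a (proj S i i a)"
  using assms unfolding factor_system_def by auto

lemma factor_systemD2:
  assumes "factor_system S" "i \<le> i'"
  shows "\<And>a. a \<in> Lev S i \<Longrightarrow> emb S i i' a \<in> Lev S i'"
    and "\<And>a. a \<in> Lev S i' \<Longrightarrow> proj S i i' a \<in> Lev S i"
    and "\<And>a b. a \<in> Lev S i \<Longrightarrow> b \<in> Lev S i \<Longrightarrow> cons S i i a b \<Longrightarrow>
           cons S i' i' (emb S i i' a) (emb S i i' b)"
    and "\<And>a b. a \<in> Lev S i' \<Longrightarrow> b \<in> Lev S i' \<Longrightarrow> cons S i' i' a b \<Longrightarrow>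
           cons S i i (proj S i i' a) (proj S i i' b)"
    and "\<And>a. a \<in> Lev S i \<Longrightarrow> cons S i i (proj S i i' (emb S i i' a)) a"
  using assms(1)[unfolded factor_system_def, THEN conjunct2, THEN conjunct1, rule_format, OF assms(2)]
  by auto

lemma factor_systemD3:
  assumes "factor_system S" "i \<le> i'" "i' \<le> i''"
  shows "\<And>a. a \<in> Lev S i \<Longrightarrow>
           cons S i'' i'' (emb S i' i'' (emb S i i' a)) (emb S i i'' a)"
    and "\<And>a. a \<in> Lev S i'' \<Longrightarrow>
           cons S i i (proj S i i' (proj S i' i'' a)) (proj S i i'' a)"
    and "\<And>a a'. a' \<in> Lev S i' \<Longrightarrow> a \<in> Lev S i \<Longrightarrow> Pred S i' i a' a \<Longrightarrow>
           Pred S i'' i (emb S i' i'' a') a"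
    and "\<And>a a''. a'' \<in> Lev S i'' \<Longrightarrow> a \<in> Lev S i \<Longrightarrow> Pred S i'' i a'' a \<Longrightarrow>
           Pred S i' i (proj S i' i'' a'') a"
  using assms(1)[unfolded factor_system_def, THEN conjunct2, THEN conjunct2, THEN conjunct2,
      rule_format, OF conjI[OF assms(2,3)]]
  by auto

text \<open>Meant for \<open>F = Emb T\<close> and \<open>A = AP M\<close>: all axioms move to the
  internal system at once. Consistency transfers because every possible witness in a level of
  \<open>A\<close> is an image under \<open>F\<close>.\<close>

lemma factor_system_transport:
  fixes S :: "('i::preorder, 'a) fsystem" and A :: "('i, 'b) fsystem"
  assumes S: "factor_system S"
    and inj: "\<And>i. inj_on (F i) (Lev S i)"
    and Lev: "\<And>i. Lev A i = F i ` Lev S i"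
    and Pred: "\<And>i i' x x'. i \<le> i' \<Longrightarrow> x' \<in> Lev S i' \<Longrightarrow> x \<in> Lev S i \<Longrightarrow>
                 Pred A i' i (F i' x') (F i x) \<longleftrightarrow> Pred S i' i x' x"
    and emb: "\<And>i i' x. i \<le> i' \<Longrightarrow> x \<in> Lev S i \<Longrightarrow> emb A i i' (F i x) = F i' (emb S i i' x)"
    and proj: "\<And>i i' x. i \<le> i' \<Longrightarrow> x \<in> Lev S i' \<Longrightarrow> proj A i i' (F i' x) = F i (proj S i i' x)"
  shows "factor_system A"
    and "\<And>i j x y. x \<in> Lev S i \<Longrightarrow> y \<in> Lev S j \<Longrightarrow>
           cons A i j (F i x) (F j y) \<longleftrightarrow> cons S i j x y"
proof -
  show cons: "cons A i j (F i x) (F j y) \<longleftrightarrow> cons S i j x y"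
    if "x \<in> Lev S i" "y \<in> Lev S j" for i j x y
  proof -
    have "cons A i j (F i x) (F j y) \<longleftrightarrow> (\<exists>k c. i \<le> k \<and> j \<le> k \<and> c \<in> Lev S k \<and>
        Pred A k i (F k c) (F i x) \<and> Pred A k j (F k c) (F j y))"
      unfolding cons_def Lev by blast
    then show ?thesis
      unfolding cons_def using Pred that by meson
  qed
  note D = factor_systemD[OF S] factor_systemD2[OF S] factor_systemD3[OF S]
  have sys: "system S" and pre: "\<And>i i' a' a. i \<le> i' \<Longrightarrow> a' \<in> Lev S i' \<Longrightarrow> a \<in> Lev S i \<Longrightarrow>
      cons S i' i a' a \<longleftrightarrow> Pred S i' i a' a"
    using D(1) unfolding prefactor_system_def by blast+
  have "prefactor_system A"
    using sys unfolding prefactor_system_def system_def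
    by (auto simp: Lev cons Pred pre)
  show "factor_system A"
    unfolding factor_system_def
  proof (rule conjI[OF \<open>prefactor_system A\<close>], intro conjI allI impI)
    fix i i' :: 'i assume i: "i \<le> i'"
    show "emb A i i' \<in> Lev A i \<rightarrow> Lev A i'" "proj A i i' \<in> Lev A i' \<rightarrow> Lev A i"
      using i by (auto simp: Lev emb proj D)
    show "\<forall>a\<in>Lev A i. \<forall>b\<in>Lev A i.
        cons A i i a b \<longrightarrow> cons A i' i' (emb A i i' a) (emb A i i' b)"
      using i by (auto simp: Lev emb cons D)
    show "\<forall>a\<in>Lev A i'. \<forall>b\<in>Lev A i'.
        cons A i' i' a b \<longrightarrow> cons A i i (proj A i i' a) (proj A i i' b)"
      using i by (auto simp: Lev proj cons D)
    show "\<forall>a\<in>Lev A i. cons A i i (proj A i i' (emb A i i' a)) a"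
      using i by (auto simp: Lev emb proj cons D)
  next
    fix i
    show "\<forall>a\<in>Lev A i. cons A i i (emb A i i a) a \<and> cons A i i a (proj A i i a)"
      by (auto simp: Lev emb proj cons D)
  next
    fix i i' i'' :: 'i assume i: "i \<le> i' \<and> i' \<le> i''"
    then have i': "i \<le> i''"
      using order_trans by blast
    show "\<forall>a\<in>Lev A i. cons A i'' i'' (emb A i' i'' (emb A i i' a)) (emb A i i'' a)"
      using i i' by (auto simp: Lev emb cons D)
    show "\<forall>a\<in>Lev A i''. cons A i i (proj A i i' (proj A i' i'' a)) (proj A i i'' a)"
      using i i' by (auto simp: Lev proj cons D)
    show "\<forall>a'\<in>Lev A i'. \<forall>a\<in>Lev A i. Pred A i' i a' a \<longrightarrow> Pred A i'' i (emb A i' i'' a') a"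
      using i i' by (auto simp: Lev emb Pred D)
    show "\<forall>a''\<in>Lev A i''. \<forall>a\<in>Lev A i.
        Pred A i'' i a'' a \<longrightarrow> Pred A i' i (proj A i' i'' a'') a"
      using i i' by (auto simp: Lev proj Pred D)
  qed
qed


section \<open>Factor systems with discrete levels\<close>

text \<open>Discreteness is stated for \<open>cons\<close>; inside a level the prefactor law
  identifies it with \<open>Pred\<close>. The laws that hold up to consistency thereby become
  equations.\<close>

locale discrete_factor_system =
  fixes D :: "'i::preorder filter" and S :: "('i, 'a) fsystem"
  assumes index_filter: "index_filter D"
    and factor_system: "factor_system S"
    and discrete: "x \<in> Lev S i \<Longrightarrow> y \<in> Lev S i \<Longrightarrow> cons S i i x y \<longleftrightarrow> x = y"
begin

lemmas prefactor_system = factor_systemD(1)[OF factor_system]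

lemma Pred_refl: "x \<in> Lev S i \<Longrightarrow> Pred S i i x x"
  using prefactor_system unfolding prefactor_system_def system_def by blast

lemma Pred_discrete: "x \<in> Lev S i \<Longrightarrow> y \<in> Lev S i \<Longrightarrow> Pred S i i x y \<longleftrightarrow> x = y"
  using prefactor_system discrete unfolding prefactor_system_def by blast

lemmas emb_Lev = factor_systemD2(1)[OF factor_system]
lemmas proj_Lev = factor_systemD2(2)[OF factor_system]
lemmas Pred_emb = factor_systemD3(3)[OF factor_system]
lemmas Pred_proj = factor_systemD3(4)[OF factor_system]

lemma proj_emb:
  assumes "i \<le> i'" "x \<in> Lev S i"
  shows "proj S i i' (emb S i i' x) = x"
  using factor_systemD2(5)[OF factor_system assms] discrete proj_Lev emb_Lev assms by blast

lemma emb_emb: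
  assumes "i \<le> i'" "i' \<le> i''" "x \<in> Lev S i"
  shows "emb S i' i'' (emb S i i' x) = emb S i i'' x"
  using factor_systemD3(1)[OF factor_system assms] discrete emb_Lev assms order_trans[OF assms(1,2)]
  by simp

lemma proj_proj:
  assumes "i \<le> i'" "i' \<le> i''" "x \<in> Lev S i''"
  shows "proj S i i' (proj S i' i'' x) = proj S i i'' x"
  using factor_systemD3(2)[OF factor_system assms] discrete proj_Lev assms order_trans[OF assms(1,2)]
  by simp

text \<open>Projecting \<open>x'\<close> down to level \<open>i\<close> preserves its relation to
  \<open>x\<close>, and within one level that relation is equality.\<close>

lemma Pred_imp_proj_eq:
  assumes "i \<le> i'" "x' \<in> Lev S i'" "x \<in> Lev S i" "Pred S i' i x' x"
  shows "proj S i i' x' = x"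
  using Pred_proj[OF order_refl assms] Pred_discrete proj_Lev assms by blast

lemma consistent_set_unique:
  assumes "consistent_set D S \<alpha>" "(i, x) \<in> \<alpha>" "(i, y) \<in> \<alpha>"
  shows "x = y"
  using consistent_set_Pred[OF assms order_refl] Pred_discrete
    consistent_set_Lev[OF assms(1,2)] consistent_set_Lev[OF assms(1,3)] by simp

text \<open>Embeddings compose with equality, so of two members the higher is the embedding of the
  lower one \<open>y\<close>. The embedding law applied to reflexivity at \<open>y\<close> then
  relates them. The levels met form the cone above \<open>i\<close>, a non-empty up-set.\<close>

lemma consistent_set_emb:
  assumes x: "x \<in> Lev S i"
  shows "consistent_set D S {(i', emb S i i' x) | i'. i \<le> i'}"
  unfolding consistent_set_def
proof (intro conjI allI impI)
  show "{(i', emb S i i' x) | i'. i \<le> i'} \<subseteq> Sigma UNIV (Lev S)"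
    using emb_Lev[OF _ x] by auto
next
  fix j j' y y'
  assume "(j', y') \<in> {(i', emb S i i' x) | i'. i \<le> i'} \<and>
          (j, y) \<in> {(i', emb S i i' x) | i'. i \<le> i'} \<and> j \<le> j'"
  then have j: "i \<le> j" "j \<le> j'" "y = emb S i j x" "y' = emb S i j' x"
    by auto
  then have y: "y \<in> Lev S j"
    using emb_Lev x by blast
  have "Pred S j' j (emb S j j' y) y"
    using Pred_emb[OF order_refl j(2) y y] Pred_refl y by blast
  then show "Pred S j' j y' y"
    using emb_emb[OF j(1,2) x] j(3,4) by simp
next
  have "up_set {i'. i \<le> i'}" "{i'. i \<le> i'} \<noteq> {}"
    unfolding up_set_def by (auto intro: order_trans)
  then have "\<forall>\<^sub>F i' in D. i' \<in> {i'. i \<le> i'}"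
    using index_filter unfolding index_filter_def by blast
  then show "\<forall>\<^sub>F i' in D. \<exists>y. (i', y) \<in> {(i', emb S i i' x) | i'. i \<le> i'}"
    by simp
qed

text \<open>Makes the arbitrary choice in \<open>Proj (EL D S)\<close> harmless. An element of
  \<open>\<alpha>\<close> above both \<open>j\<close> and \<open>k\<close> projects to
  \<open>x\<close> and to \<open>y\<close>, and projections compose with equality.\<close>

lemma proj_consistent_eq:
  assumes \<alpha>: "consistent_set D S \<alpha>" and "(j, x) \<in> \<alpha>" "(k, y) \<in> \<alpha>" "i \<le> j" "i \<le> k"
  shows "proj S i j x = proj S i k y"
proof -
  obtain l z where l: "j \<le> l" "k \<le> l" "(l, z) \<in> \<alpha>"
    using consistent_set_above2[OF index_filter \<alpha>] .
  note L = consistent_set_Lev[OF \<alpha>] and P = consistent_set_Pred[OF \<alpha>]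
  have "proj S j l z = x" "proj S k l z = y"
    using Pred_imp_proj_eq[OF l(1) L[OF l(3)] L[OF assms(2)] P[OF l(3) assms(2) l(1)]]
      Pred_imp_proj_eq[OF l(2) L[OF l(3)] L[OF assms(3)] P[OF l(3) assms(3) l(2)]] by simp_all
  then show ?thesis
    using proj_proj[of i j l z] proj_proj[of i k l z] l assms L by auto
qed

section \<open>Maximal consistent sets as a target\<close>

lemma Carr_EL_consistent: "\<alpha> \<in> Carr (EL D S) \<Longrightarrow> consistent_set D S \<alpha>"
  unfolding EL_def max_consistent_sets_def by simp

text \<open>To recognise a maximal set as an embedded point it suffices to find the chain of
  embeddings in it, since only one maximal set contains that chain.\<close>

lemma Emb_EL:
  assumes "x \<in> Lev S i" "\<beta> \<in> Carr (EL D S)" "\<And>i'. i \<le> i' \<Longrightarrow> (i', emb S i i' x) \<in> \<beta>"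
  shows "Emb (EL D S) i x = \<beta>"
proof -
  have "maximalization D S {(i', emb S i i' x) | i'. i \<le> i'} = \<beta>"
    by (rule maximalization_eqI[OF index_filter prefactor_system consistent_set_emb])
       (use assms in \<open>auto simp: EL_def\<close>)
  then show ?thesis
    by (simp add: EL_def)
qed

lemma Emb_EL_hull:
  assumes "x \<in> Lev S i"
  shows "Emb (EL D S) i x = consistent_hull S {(i', emb S i i' x) | i'. i \<le> i'}"
  using maximalization_eq_hull[OF index_filter prefactor_system consistent_set_emb[OF assms]]
  by (simp add: EL_def)

lemma Emb_EL_Carr: "x \<in> Lev S i \<Longrightarrow> Emb (EL D S) i x \<in> Carr (EL D S)"
  using hull_max_consistent[OF index_filter prefactor_system consistent_set_emb] Emb_EL_hull
  by (simp add: EL_def)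

lemma emb_mem_Emb_EL:
  assumes "x \<in> Lev S i" "i \<le> i'"
  shows "(i', emb S i i' x) \<in> Emb (EL D S) i x"
  using consistent_subset_hull[OF consistent_set_emb subset_refl, of x i] Emb_EL_hull assms
  by auto

lemma Proj_EL:
  assumes "\<alpha> \<in> Carr (EL D S)" "(j, x) \<in> \<alpha>" "i \<le> j"
  shows "Proj (EL D S) i \<alpha> = proj S i j x"
proof -
  define y where "y = (SOME y. y \<in> \<alpha> \<and> i \<le> fst y)"
  have "y \<in> \<alpha> \<and> i \<le> fst y"
    unfolding y_def using assms by (intro someI_ex[of "\<lambda>y. y \<in> \<alpha> \<and> i \<le> fst y"]) force
  then have "proj S i (fst y) (snd y) = proj S i j x"
    using proj_consistent_eq[OF Carr_EL_consistent[OF assms(1)], of "fst y" "snd y" j x i] assms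
    by simp
  then show ?thesis
    by (simp add: EL_def y_def[symmetric] case_prod_beta)
qed

text \<open>A single element \<open>z\<close> of \<open>\<alpha>\<close> computes the projections to
  all levels below \<open>k\<close>, so the target laws for \<open>Proj\<close> reduce to laws of
  \<open>proj S\<close> at \<open>z\<close>.\<close>

lemma Proj_EL_obtain:
  assumes \<alpha>: "\<alpha> \<in> Carr (EL D S)"
  obtains k z where "i \<le> k" "(k, z) \<in> \<alpha>" "z \<in> Lev S k"
    "\<And>j. j \<le> k \<Longrightarrow> Proj (EL D S) j \<alpha> = proj S j k z"
proof -
  obtain k z where k: "i \<le> k" "(k, z) \<in> \<alpha>"
    using consistent_set_above[OF index_filter Carr_EL_consistent[OF \<alpha>]] .
  then show thesis
    using that[OF k] Proj_EL[OF \<alpha> k(2)] consistent_set_Lev[OF Carr_EL_consistent[OF \<alpha>]] by blast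
qed

lemma is_target_EL: "is_target D S (EL D S)"
  unfolding is_target_def
proof (intro conjI allI ballI impI funcsetI)
  fix i x assume "x \<in> Lev S i"
  then show "Emb (EL D S) i x \<in> Carr (EL D S)"
    by (rule Emb_EL_Carr)
next
  fix i :: 'i and \<alpha> assume \<alpha>: "\<alpha> \<in> Carr (EL D S)"
  obtain k z where "i \<le> k" "(k, z) \<in> \<alpha>" "z \<in> Lev S k"
    "\<And>j. j \<le> k \<Longrightarrow> Proj (EL D S) j \<alpha> = proj S j k z"
    using Proj_EL_obtain[OF \<alpha>, of i] by blast
  then show "Proj (EL D S) i \<alpha> \<in> Lev S i"
    using proj_Lev by simp
next
  fix \<alpha> assume \<alpha>: "\<alpha> \<in> Carr (EL D S)"
  then have "\<forall>\<^sub>F i in D. \<exists>x. (i, x) \<in> \<alpha>"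
    using Carr_EL_consistent unfolding consistent_set_def by blast
  then show "\<forall>\<^sub>F i in D. \<exists>x\<in>Lev S i. Appr (EL D S) \<alpha> i x"
    using consistent_set_Lev[OF Carr_EL_consistent[OF \<alpha>]]
    by (auto simp: EL_def elim!: eventually_mono)
next
  fix i x y assume "x \<in> Lev S i" "y \<in> Lev S i" "cons S i i x y"
  then show "Emb (EL D S) i x = Emb (EL D S) i y"
    using discrete by blast
next
  fix i x assume x: "x \<in> Lev S i"
  have "Proj (EL D S) i (Emb (EL D S) i x) = x"
    using Proj_EL[OF Emb_EL_Carr emb_mem_Emb_EL order_refl, OF x x order_refl] proj_emb x by simp
  then show "cons S i i (Proj (EL D S) i (Emb (EL D S) i x)) x"
    using discrete x by simp
next
  fix i i' :: 'i and \<alpha> x' x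
  assume "i \<le> i'" "\<alpha> \<in> Carr (EL D S)" "Appr (EL D S) \<alpha> i' x' \<and> Appr (EL D S) \<alpha> i x"
  then show "Pred S i' i x' x"
    using consistent_set_Pred[OF Carr_EL_consistent] by (auto simp: EL_def)
next
  fix i i' :: 'i and x assume i: "i \<le> i'" and x: "x \<in> Lev S i"
  \<comment> \<open>The chain that starts at \<open>emb S i i' x\<close> is part of the chain that
    starts at \<open>x\<close>.\<close>
  show "Emb (EL D S) i' (emb S i i' x) = Emb (EL D S) i x"
  proof (rule Emb_EL)
    fix i'' assume "i' \<le> i''"
    then show "(i'', emb S i' i'' (emb S i i' x)) \<in> Emb (EL D S) i x"
      using emb_emb[OF i _ x] emb_mem_Emb_EL[OF x] order_trans[OF i] by simp
  qed (use i x emb_Lev Emb_EL_Carr in auto)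
next
  fix i i' :: 'i and x' x assume "i \<le> i'" "x' \<in> Lev S i'" "x \<in> Lev S i" "Pred S i' i x' x"
  \<comment> \<open>Every embedding of \<open>x'\<close> is still related to \<open>x\<close>, which
    is exactly membership in the hull of the chain of \<open>x'\<close>.\<close>
  then have "(i, x) \<in> consistent_hull S {(j, emb S i' j x') | j. i' \<le> j}"
    using Pred_emb by (auto simp: consistent_hull_def)
  then show "Appr (EL D S) (Emb (EL D S) i' x') i x"
    using Emb_EL_hull[OF \<open>x' \<in> Lev S i'\<close>] by (simp add: EL_def)
next
  fix i i' :: 'i and \<alpha> assume i: "i \<le> i'" and \<alpha>: "\<alpha> \<in> Carr (EL D S)"
  obtain k z where k: "i' \<le> k" "(k, z) \<in> \<alpha>" "z \<in> Lev S k"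
    "\<And>j. j \<le> k \<Longrightarrow> Proj (EL D S) j \<alpha> = proj S j k z"
    using Proj_EL_obtain[OF \<alpha>, of i'] by blast
  then show "cons S i i (proj S i i' (Proj (EL D S) i' \<alpha>)) (Proj (EL D S) i \<alpha>)"
    using discrete proj_Lev proj_proj i order_trans[OF i k(1)] by simp
next
  fix i i' :: 'i and \<alpha> x
  assume i: "i \<le> i'" and \<alpha>: "\<alpha> \<in> Carr (EL D S)" and x: "x \<in> Lev S i" "Appr (EL D S) \<alpha> i x"
  obtain k z where k: "i' \<le> k" "(k, z) \<in> \<alpha>" "z \<in> Lev S k"
    "\<And>j. j \<le> k \<Longrightarrow> Proj (EL D S) j \<alpha> = proj S j k z"
    using Proj_EL_obtain[OF \<alpha>, of i'] by blast
  moreover have "Pred S k i z x"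
    using consistent_set_Pred[OF Carr_EL_consistent[OF \<alpha>] k(2)] x order_trans[OF i k(1)]
    by (simp add: EL_def)
  ultimately show "Pred S i' i (Proj (EL D S) i' \<alpha>) x"
    using Pred_proj i x by simp
qed

end


section \<open>Targets of discrete factor systems\<close>

locale discrete_target = discrete_factor_system D S
  for D :: "'i::preorder filter" and S :: "('i, 'a) fsystem" +
  fixes T :: "('i, 'a, 'm) target"
  assumes is_target: "is_target D S T"
begin

abbreviation M :: "('i, 'm) pset" where
  "M \<equiv> pset_of_target S T"

lemma Emb_Carr: "x \<in> Lev S i \<Longrightarrow> Emb T i x \<in> Carr T"
  and Proj_Lev: "a \<in> Carr T \<Longrightarrow> Proj T i a \<in> Lev S i"
  and eventually_Appr: "a \<in> Carr T \<Longrightarrow> \<forall>\<^sub>F i in D. \<exists>x\<in>Lev S i. Appr T a i x"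
  using is_target unfolding is_target_def Pi_iff by simp_all

lemma Proj_Emb: "x \<in> Lev S i \<Longrightarrow> Proj T i (Emb T i x) = x"
  using is_target discrete Proj_Lev Emb_Carr unfolding is_target_def by simp

lemma is_target_mono:
  assumes "i \<le> i'"
  shows "a \<in> Carr T \<Longrightarrow> x' \<in> Lev S i' \<Longrightarrow> x \<in> Lev S i \<Longrightarrow>
           Appr T a i' x' \<Longrightarrow> Appr T a i x \<Longrightarrow> Pred S i' i x' x"
    and "x \<in> Lev S i \<Longrightarrow> Emb T i' (emb S i i' x) = Emb T i x"
    and "x' \<in> Lev S i' \<Longrightarrow> x \<in> Lev S i \<Longrightarrow> Pred S i' i x' x \<Longrightarrow> Appr T (Emb T i' x') i x"
    and "a \<in> Carr T \<Longrightarrow> cons S i i (proj S i i' (Proj T i' a)) (Proj T i a)"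
    and "a \<in> Carr T \<Longrightarrow> x \<in> Lev S i \<Longrightarrow> Appr T a i x \<Longrightarrow> Pred S i' i (Proj T i' a) x"
  using is_target[unfolded is_target_def, THEN conjunct2, THEN conjunct2, THEN conjunct2,
      THEN conjunct2, THEN conjunct2, rule_format, OF assms] by auto

lemmas Appr_Pred = is_target_mono(1)
lemmas Emb_emb = is_target_mono(2)
lemmas Pred_imp_Appr_Emb = is_target_mono(3)
lemmas Appr_imp_Pred_Proj = is_target_mono(5)

lemma proj_Proj: "i \<le> i' \<Longrightarrow> a \<in> Carr T \<Longrightarrow> proj S i i' (Proj T i' a) = Proj T i a"
  using is_target_mono(4)[of i i' a] discrete Proj_Lev proj_Lev by simp

lemma Emb_inj: "x \<in> Lev S i \<Longrightarrow> y \<in> Lev S i \<Longrightarrow> Emb T i x = Emb T i y \<longleftrightarrow> x = y"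
  using Proj_Emb by metis

text \<open>The approximation law at equal indices puts \<open>Proj T i a\<close> and
  \<open>x\<close> in relation within one level. So \<open>Proj\<close> returns the approximation of
  \<open>a\<close> at level \<open>i\<close> whenever there is one.\<close>

lemma Appr_imp_Proj_eq: "a \<in> Carr T \<Longrightarrow> x \<in> Lev S i \<Longrightarrow> Appr T a i x \<Longrightarrow> Proj T i a = x"
  using Appr_imp_Pred_Proj[OF order_refl] Pred_discrete Proj_Lev by blast

text \<open>From left to right, the approximation passes to \<open>Proj T i' (Emb T i' x')\<close>,
  which is \<open>x'\<close> itself.\<close>

lemma Appr_Emb_iff:
  assumes "i \<le> i'" "x' \<in> Lev S i'" "x \<in> Lev S i"
  shows "Appr T (Emb T i' x') i x \<longleftrightarrow> Pred S i' i x' x"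
proof
  show "Pred S i' i x' x" if "Appr T (Emb T i' x') i x"
    using Appr_imp_Pred_Proj[OF assms(1) Emb_Carr assms(3) that] Proj_Emb assms by simp
  show "Appr T (Emb T i' x') i x" if "Pred S i' i x' x"
    using Pred_imp_Appr_Emb assms that by simp
qed

lemma Appr_Emb_self: "x \<in> Lev S i \<Longrightarrow> y \<in> Lev S i \<Longrightarrow> Appr T (Emb T i x) i y \<longleftrightarrow> x = y"
  using Appr_Emb_iff[OF order_refl] Pred_discrete by simp

lemma Proj_Emb_le: "i \<le> i' \<Longrightarrow> x \<in> Lev S i' \<Longrightarrow> Proj T i (Emb T i' x) = proj S i i' x"
  using proj_Proj[OF _ Emb_Carr] Proj_Emb by metis

lemma Per_iff: "Per M i a b \<longleftrightarrow> (\<exists>x\<in>Lev S i. Appr T a i x \<and> Appr T b i x)"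
  unfolding pset_of_target_def using discrete by auto

lemma Per_Emb_iff: "x \<in> Lev S i \<Longrightarrow> Per M i a (Emb T i x) \<longleftrightarrow> Appr T a i x"
  unfolding Per_iff using Appr_Emb_self by auto

lemma Dom_iff: "a \<in> Dom M i \<longleftrightarrow> a \<in> Carr T \<and> (\<exists>x\<in>Lev S i. Appr T a i x)"
  unfolding Dom_def Per_iff by (simp add: pset_of_target_def)

lemma pset_simps [simp]:
  "PCarr M = Carr T" "Pt M i a = Emb T i (Proj T i a)" "Pts M i = Emb T i ` Lev S i"
  by (simp_all add: pset_of_target_def)

text \<open>On \<open>Dom M i\<close> the relation \<open>Per M i\<close> is equality of
  \<open>Proj T i\<close>, and the axioms are read off from this.\<close>

lemma PER_set_M: "PER_set D M"
  unfolding PER_set_def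
proof (intro conjI allI ballI impI)
  fix i
  show "symp_on (PCarr M) (Per M i)"
    unfolding symp_on_def Per_iff by blast
  show "transp_on (PCarr M) (Per M i)"
    unfolding transp_on_def Per_iff pset_simps by (metis Appr_imp_Proj_eq)
  show "Pts M i \<subseteq> PCarr M"
    using Emb_Carr by auto
  show "Pt M i \<in> PCarr M \<rightarrow> Pts M i"
    using Proj_Lev by auto
  have "Emb T i x \<in> Pt M i ` Dom M i" if "x \<in> Lev S i" for x
    using that Emb_Carr Appr_Emb_self Proj_Emb
    by (intro image_eqI[of _ _ "Emb T i x"]) (auto simp: Dom_iff)
  then show "Pt M i ` Dom M i = Pts M i"
    using Proj_Lev by (auto simp: Dom_iff)
next
  fix a assume "a \<in> PCarr M"
  then show "\<forall>\<^sub>F i in D. a \<in> Dom M i"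
    using eventually_Appr by (simp add: Dom_iff)
next
  fix i a b assume ab: "a \<in> PCarr M" "b \<in> PCarr M" and "Per M i a b"
  then obtain x where x: "x \<in> Lev S i" "Appr T a i x" "Appr T b i x"
    unfolding Per_iff by blast
  then have "Proj T i a = x" "Proj T i b = x"
    using Appr_imp_Proj_eq ab by auto
  with x show "Per M i a (Pt M i a)" "Pt M i a = Pt M i b"
    using Per_Emb_iff by simp_all
next
  fix i i' :: 'i and a b
  assume i: "i \<le> i'" and ab: "a \<in> Dom M i" "b \<in> Dom M i" and "Per M i' a b"
  then have c: "a \<in> Carr T" "b \<in> Carr T"
    by (simp_all add: Dom_iff)
  then have "Proj T i' a = Proj T i' b"
    using \<open>Per M i' a b\<close> Appr_imp_Proj_eq unfolding Per_iff by metis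
  \<comment> \<open>Equal projections at level \<open>i'\<close> project to equal ones at level
    \<open>i\<close>; membership in \<open>Dom M i\<close> then supplies the common approximation
    there.\<close>
  then have "Proj T i a = Proj T i b"
    using proj_Proj[OF i] c by metis
  then show "Per M i a b"
    using ab Appr_imp_Proj_eq unfolding Dom_iff Per_iff by metis
next
  fix i i' :: 'i assume i: "i \<le> i'"
  then show "Pts M i \<subseteq> Pts M i'"
    using emb_Lev Emb_emb by (metis image_eqI image_subsetI pset_simps(3))
next
  fix i i' :: 'i and a assume i: "i \<le> i'" and "a \<in> Dom M i"
  then show "Pt M i' a \<in> Dom M i"
    using Emb_Carr Proj_Lev Appr_Emb_iff[OF i] Appr_imp_Pred_Proj[OF i]
    unfolding Dom_iff pset_simps by blast
next
  fix i i' :: 'i and a assume i: "i \<le> i'" and "a \<in> PCarr M"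
  then show "Pt M i a = Pt M i (Pt M i' a)"
    using Proj_Emb_le[OF i] proj_Proj[OF i] Proj_Lev by simp
qed

section \<open>The internal system of a target\<close>

lemma AP_simps [simp]:
  "Lev (AP M) i = Emb T i ` Lev S i" "Pred (AP M) i' i = Per M i"
  "emb (AP M) i i' b = b" "proj (AP M) i i' b = Emb T i (Proj T i b)"
  by (simp_all add: AP_def)

lemma Pred_AP_iff:
  "i \<le> i' \<Longrightarrow> x' \<in> Lev S i' \<Longrightarrow> x \<in> Lev S i \<Longrightarrow>
     Pred (AP M) i' i (Emb T i' x') (Emb T i x) \<longleftrightarrow> Pred S i' i x' x"
  by (simp add: Per_Emb_iff Appr_Emb_iff)

text \<open>Each \<open>Emb T i\<close> is injective on its level and intertwines the structures. In
  particular the inclusions of points correspond to \<open>emb\<close>, because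
  \<open>Emb T i' (emb S i i' x) = Emb T i x\<close>.\<close>

lemma factor_system_AP: "factor_system (AP M)"
  and cons_AP_iff: "x \<in> Lev S i \<Longrightarrow> y \<in> Lev S j \<Longrightarrow>
    cons (AP M) i j (Emb T i x) (Emb T j y) \<longleftrightarrow> cons S i j x y"
proof -
  note transport = factor_system_transport[where F = "Emb T" and A = "AP M",
      OF factor_system _ AP_simps(1) Pred_AP_iff]
  have inj: "inj_on (Emb T i) (Lev S i)" for i
    using Emb_inj by (blast intro: inj_onI)
  show "factor_system (AP M)"
    by (rule transport(1)) (simp_all add: inj Emb_emb Proj_Emb_le)
  show "cons (AP M) i j (Emb T i x) (Emb T j y) \<longleftrightarrow> cons S i j x y"
    if "x \<in> Lev S i" "y \<in> Lev S j"
    by (rule transport(2)) (simp_all add: that inj Emb_emb Proj_Emb_le)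
qed

text \<open>Stated for any target, so that it serves for \<open>EL D S\<close> as well as for
  \<open>T\<close>.\<close>

lemma fs_iso_AP: "fs_iso S (AP M)"
proof -
  have "fs_hom S (AP M) id (Emb T)"
    unfolding fs_hom_def
    by (auto simp: Per_Emb_iff Appr_Emb_iff Emb_emb Proj_Emb_le)
  \<comment> \<open>Embeddings of \<open>AP M\<close> are inclusions, so commuting with them means
    \<open>Proj T i' (Emb T i x) = emb S i i' x\<close>.\<close>
  moreover have "fs_hom (AP M) S id (Proj T)"
    unfolding fs_hom_def
    using Emb_Carr
    by (auto simp: Proj_Emb Per_Emb_iff Appr_Emb_iff Proj_Lev Proj_Emb_le proj_Lev)
      (metis Emb_emb Proj_Emb emb_Lev)
  ultimately show ?thesis
    unfolding fs_iso_def using factor_system factor_system_AP Proj_Emb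
    by (intro conjI exI[of _ id] exI[of _ "Emb T"] exI[of _ "Proj T"]) auto
qed

lemma consistent_set_Ext: "a \<in> Carr T \<Longrightarrow> consistent_set D S (Ext S T a)"
  unfolding consistent_set_def Ext_def using Appr_Pred eventually_Appr
  by (auto simp: Bex_def)

end

section \<open>Maximal targets and the comparison map into maximal consistent sets\<close>

locale discrete_maximal_target = discrete_target D S T
  for D :: "'i::preorder filter" and S :: "('i, 'a) fsystem" and T :: "('i, 'a, 'm) target" +
  assumes Ext_Carr_EL: "a \<in> Carr T \<Longrightarrow> Ext S T a \<in> Carr (EL D S)"
begin

text \<open>The point \<open>Emb T i x\<close> is also \<open>Emb T i' (emb S i i' x)\<close>, hence
  is approximated by every embedding of \<open>x\<close>. Its extension is maximal and contains the
  whole chain.\<close>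

lemma Ext_Emb:
  assumes x: "x \<in> Lev S i"
  shows "Ext S T (Emb T i x) = Emb (EL D S) i x"
proof (rule Emb_EL[OF x Ext_Carr_EL[OF Emb_Carr[OF x]], symmetric])
  fix i' assume i: "i \<le> i'"
  have "Appr T (Emb T i' (emb S i i' x)) i' (emb S i i' x)"
    using Appr_Emb_self emb_Lev i x by simp
  then show "(i', emb S i i' x) \<in> Ext S T (Emb T i x)"
    using Emb_emb emb_Lev i x by (simp add: Ext_def)
qed

text \<open>At a level \<open>k\<close> above \<open>i\<close> where \<open>a\<close> has an
  approximation, both sides start from that same element and project it down.\<close>

lemma Proj_Ext:
  assumes a: "a \<in> Carr T"
  shows "Proj (EL D S) i (Ext S T a) = Proj T i a"
proof -
  obtain k z where k: "i \<le> k" "(k, z) \<in> Ext S T a" "z \<in> Lev S k"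
    "\<And>j. j \<le> k \<Longrightarrow> Proj (EL D S) j (Ext S T a) = proj S j k z"
    using Proj_EL_obtain[OF Ext_Carr_EL[OF a], of i] by blast
  then have "Proj T k a = z"
    using Appr_imp_Proj_eq a by (simp add: Ext_def)
  with k show ?thesis
    using proj_Proj a by metis
qed

text \<open>Elements with equal extensions are related at every level where they are approximated,
  and these levels are cofinal.\<close>

lemma inj_on_Ext:
  assumes "extensional_pset M"
  shows "inj_on (Ext S T) (Carr T)"
proof (rule inj_onI)
  fix a b assume ab: "a \<in> Carr T" "b \<in> Carr T" "Ext S T a = Ext S T b"
  have "\<forall>\<^sub>F i in D. i \<in> {i. Per M i a b}"
    using eventually_Appr[OF ab(1)]
  proof eventually_elim
    fix i assume "\<exists>x\<in>Lev S i. Appr T a i x"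
    then show "i \<in> {i. Per M i a b}"
      using ab(3) unfolding Ext_def Per_iff by blast
  qed
  then have "cofinal {i. Per M i a b}"
    using index_filter unfolding index_filter_def by blast
  then show "a = b"
    using assms ab unfolding extensional_pset_def by simp
qed

lemma Ext_surj:
  assumes "complete_pset D M" "\<alpha> \<in> Carr (EL D S)"
  shows "\<alpha> \<in> Ext S T ` Carr T"
proof -
  note \<alpha> = Carr_EL_consistent[OF assms(2)]
  define J where "J = {i. \<exists>x. (i, x) \<in> \<alpha>}"
  \<comment> \<open>Discreteness leaves at most one element of \<open>\<alpha>\<close> per level, so
    the description is proper on \<open>J\<close>; only indices in \<open>J\<close> are
    used.\<close>
  define x where "x = (\<lambda>i. THE x. (i, x) \<in> \<alpha>)"
  have x: "x i = y" if "(i, y) \<in> \<alpha>" for i y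
    unfolding x_def using consistent_set_unique[OF \<alpha>] that by (intro the_equality) blast+
  have xJ: "(i, x i) \<in> \<alpha>" if "i \<in> J" for i
    using that x by (auto simp: J_def)
  have xL: "x i \<in> Lev S i" if "i \<in> J" for i
    using consistent_set_Lev[OF \<alpha> xJ[OF that]] .
  have J: "\<forall>\<^sub>F i in D. i \<in> J"
    using \<alpha> by (simp add: J_def consistent_set_def)
  have step: "Emb T i' (x i') \<in> Dom M i \<and> Pt M i (Emb T i' (x i')) = Emb T i (x i)"
    if "i \<in> J" "i' \<in> J" "i \<le> i'" for i i'
  proof -
    have P: "Pred S i' i (x i') (x i)"
      using consistent_set_Pred[OF \<alpha>] xJ that by blast
    then have "proj S i i' (x i') = x i"
      using Pred_imp_proj_eq that xL by simp
    then show ?thesis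
      using that xL Emb_Carr Appr_Emb_iff Proj_Emb_le P by (auto simp: Dom_iff)
  qed
  have "\<exists>a\<in>PCarr M. \<forall>i\<in>J. a \<in> Dom M i \<and> Pt M i a = Emb T i (x i)"
    using assms(1)[unfolded complete_pset_def, THEN spec[of _ J],
        THEN spec[of _ "\<lambda>i. Emb T i (x i)"]] J step xL
    by auto
  then obtain a where a: "a \<in> Carr T" "\<And>i. i \<in> J \<Longrightarrow> a \<in> Dom M i"
    "\<And>i. i \<in> J \<Longrightarrow> Emb T i (Proj T i a) = Emb T i (x i)"
    by auto
  have "\<alpha> \<subseteq> Ext S T a"
  proof clarify
    fix i y assume y: "(i, y) \<in> \<alpha>"
    then have i: "i \<in> J" "y = x i"
      using x by (auto simp: J_def)
    \<comment> \<open>The limit equation gives this after cancelling the injective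
      \<open>Emb T i\<close>. Membership in \<open>Dom M i\<close> provides some approximation of
      \<open>a\<close>, which must then be \<open>y\<close>.\<close>
    then have "Proj T i a = y"
      using a Emb_inj Proj_Lev xL by blast
    then show "(i, y) \<in> Ext S T a"
      using a(2)[OF i(1)] Appr_imp_Proj_eq unfolding Dom_iff Ext_def by auto
  qed
  \<comment> \<open>One inclusion is enough, since \<open>\<alpha>\<close> is maximal and the
    extension is consistent.\<close>
  then have "Ext S T a = \<alpha>"
    using assms(2) consistent_set_Ext[OF a(1)] by (simp add: EL_def max_consistent_sets_def)
  with a(1) show ?thesis
    by blast
qed

lemma bij_betw_Ext:
  assumes "extensional_pset M" "complete_pset D M"
  shows "bij_betw (Ext S T) (Carr T) (Carr (EL D S))"
  unfolding bij_betw_def using inj_on_Ext Ext_surj Ext_Carr_EL assms by blast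

lemma pset_iso_EL:
  assumes "extensional_pset M" "complete_pset D M"
  shows "pset_iso D M (pset_of_target S (EL D S))"
proof -
  interpret EL: discrete_target D S "EL D S"
    by unfold_locales (rule is_target_EL)
  have "Per M i a b \<longleftrightarrow> Per EL.M i (Ext S T a) (Ext S T b)" for i a b
    unfolding Per_iff EL.Per_iff by (auto simp: EL_def Ext_def)
  moreover have "Ext S T (Pt M i a) = Pt EL.M i (Ext S T a)" if "a \<in> Carr T" for i a
    using that Ext_Emb Proj_Lev Proj_Ext by simp
  ultimately show ?thesis
    unfolding pset_iso_def
    using PER_set_M EL.PER_set_M bij_betw_Ext[OF assms]
    by (intro conjI exI[of _ "Ext S T"]) auto
qed

lemma limit:
  assumes "extensional_pset M" "complete_pset D M"
  shows "is_limit TYPE('n) D S T"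
  unfolding is_limit_def
proof (intro conjI allI impI)
  show "is_target D S T"
    by (rule is_target)
next
  fix N :: "('i, 'a, 'n) target"
  assume "is_target D S N"
  then interpret N: discrete_target D S N
    by unfold_locales
  note bij = bij_betw_Ext[OF assms]
  let ?hull = "\<lambda>a. consistent_hull S (Ext S N a)"
  have hull: "?hull a \<in> Carr (EL D S)" if "a \<in> Carr N" for a
    using hull_max_consistent[OF index_filter prefactor_system N.consistent_set_Ext[OF that]]
    by (simp add: EL_def)
  \<comment> \<open>Restricting to \<open>Carr N\<close> fixes the value elsewhere, as the
    extensional function space in the uniqueness claim requires.\<close>
  define \<Phi> where "\<Phi> = (\<lambda>a\<in>Carr N. inv_into (Carr T) (Ext S T) (?hull a))"
  have \<Phi>: "\<Phi> a \<in> Carr T" "Ext S T (\<Phi> a) = ?hull a" if "a \<in> Carr N" for a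
    using hull[OF that] that bij unfolding \<Phi>_def bij_betw_def
    by (auto simp: inv_into_into f_inv_into_f)
  \<comment> \<open>The universal property becomes a statement about inclusion of
    extensions.\<close>
  have sub: "Ext S N a \<subseteq> Ext S T b \<longleftrightarrow>
      (\<forall>i. \<forall>x\<in>Lev S i. Appr N a i x \<longrightarrow> Appr T b i x)" for a b
    by (auto simp: Ext_def)
  show "\<exists>!\<Phi>. \<Phi> \<in> Carr N \<rightarrow>\<^sub>E Carr T \<and>
      (\<forall>a\<in>Carr N. \<forall>i. \<forall>x\<in>Lev S i. Appr N a i x \<longrightarrow> Appr T (\<Phi> a) i x)"
    unfolding sub[symmetric]
  proof (rule ex1I[of _ \<Phi>])
    show "\<Phi> \<in> Carr N \<rightarrow>\<^sub>E Carr T \<and> (\<forall>a\<in>Carr N. Ext S N a \<subseteq> Ext S T (\<Phi> a))"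
      using \<Phi> consistent_subset_hull[OF N.consistent_set_Ext subset_refl]
      by (auto simp: PiE_iff \<Phi>_def)
  next
    fix \<Psi> assume \<Psi>: "\<Psi> \<in> Carr N \<rightarrow>\<^sub>E Carr T \<and> (\<forall>a\<in>Carr N. Ext S N a \<subseteq> Ext S T (\<Psi> a))"
    show "\<Psi> = \<Phi>"
    proof (rule PiE_ext[of _ "Carr N" "\<lambda>_. Carr T"])
      show "\<Psi> \<in> Carr N \<rightarrow>\<^sub>E Carr T"
        using \<Psi> by blast
      show "\<Phi> \<in> Carr N \<rightarrow>\<^sub>E Carr T"
        using \<Phi> by (auto simp: PiE_iff \<Phi>_def)
      fix a assume a: "a \<in> Carr N"
      then have \<Psi>a: "\<Psi> a \<in> Carr T" "Ext S N a \<subseteq> Ext S T (\<Psi> a)"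
        using \<Psi> by auto
      \<comment> \<open>The extension of \<open>\<Psi> a\<close> is a maximal consistent set
        containing \<open>Ext S N a\<close>, hence the hull. Injectivity of \<open>Ext S T\<close>
        then forces the value.\<close>
      then have "Ext S T (\<Psi> a) = ?hull a"
        using max_consistent_eq_hull[OF index_filter prefactor_system N.consistent_set_Ext[OF a]]
          Ext_Carr_EL by (simp add: EL_def)
      then show "\<Psi> a = \<Phi> a"
        using \<Phi>[OF a] \<Psi>a bij unfolding bij_betw_def by (metis inj_onD)
    qed
  qed
qed

text \<open>
  \<open>T\<close> as a target for its own internal system; it induces the same PER-set, so the comparison
  with \<open>EL\<close> applies to it as well.
\<close>

definition internal_target :: "('i, 'm, 'm) target" where
  "internal_target =
     \<lparr> Carr = Carr T,
       Appr = (\<lambda>a i b. Per M i a b),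
       Emb = (\<lambda>i b. b),
       Proj = Pt M \<rparr>"

lemma internal_simps [simp]:
  "Carr internal_target = Carr T" "Appr internal_target a i b = Per M i a b"
  "Emb internal_target i b = b" "Proj internal_target i a = Emb T i (Proj T i a)"
  by (simp_all add: internal_target_def)

lemma discrete_AP: "b \<in> Lev (AP M) i \<Longrightarrow> c \<in> Lev (AP M) i \<Longrightarrow> cons (AP M) i i b c \<longleftrightarrow> b = c"
  using cons_AP_iff discrete by (auto simp: Emb_inj)

text \<open>Lets extensionality and completeness of \<open>M\<close> be used unchanged for the
  internal target. Internal approximation of \<open>a\<close> by the point \<open>Emb T i x\<close>
  is approximation of \<open>a\<close> by \<open>x\<close>.\<close>

lemma pset_of_internal_target: "pset_of_target (AP M) internal_target = M"
proof -
  have "(\<exists>p\<in>Lev (AP M) i. \<exists>q\<in>Lev (AP M) i. Per M i a p \<and> Per M i b q \<and> cons (AP M) i i p q)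
      \<longleftrightarrow> Per M i a b" for i a b
    using cons_AP_iff discrete
    by (auto simp: Per_Emb_iff Per_iff[of i a b])
  \<comment> \<open>Only the outer PER-set is unfolded first, so that the equivalence still matches
    \<open>Per M\<close>; the second \<open>simp\<close> unfolds \<open>M\<close>.\<close>
  then show ?thesis
    unfolding pset_of_target_def[of "AP M"]
    by (simp add: comp_def) (simp add: pset_of_target_def comp_def)
qed

lemma is_target_internal: "is_target D (AP M) internal_target"
  unfolding is_target_def
proof (intro conjI allI ballI impI funcsetI)
  fix a assume "a \<in> Carr internal_target"
  then show "\<forall>\<^sub>F i in D. \<exists>b\<in>Lev (AP M) i. Appr internal_target a i b"
    using eventually_Appr by (simp add: Per_Emb_iff)
next
  fix i i' :: 'i and a b' b
  assume "i \<le> i'" "a \<in> Carr internal_target" "b' \<in> Lev (AP M) i'" "b \<in> Lev (AP M) i"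
    "Appr internal_target a i' b' \<and> Appr internal_target a i b"
  then show "Pred (AP M) i' i b' b"
    using Appr_Pred by (auto simp: Per_Emb_iff Appr_Emb_iff)
next
  fix i i' :: 'i and a
  assume "i \<le> i'" "a \<in> Carr internal_target"
  then show "cons (AP M) i i (proj (AP M) i i' (Proj internal_target i' a))
      (Proj internal_target i a)"
    using Proj_Lev discrete_AP by (simp add: Proj_Emb_le proj_Proj)
next
  fix i i' :: 'i and a b
  assume "i \<le> i'" "a \<in> Carr internal_target" "b \<in> Lev (AP M) i" "Appr internal_target a i b"
  then show "Pred (AP M) i' i (Proj internal_target i' a) b"
    using Appr_imp_Pred_Proj Proj_Lev by (auto simp: Per_Emb_iff Appr_Emb_iff)
next
  fix i b c assume "b \<in> Lev (AP M) i" "c \<in> Lev (AP M) i" "cons (AP M) i i b c"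
  then show "Emb internal_target i b = Emb internal_target i c"
    using discrete_AP by simp
next
  fix i b assume "b \<in> Lev (AP M) i"
  then show "cons (AP M) i i (Proj internal_target i (Emb internal_target i b)) b"
    using cons_AP_iff discrete by (auto simp: Proj_Emb)
qed (use Emb_Carr Proj_Lev in auto)

text \<open>A consistent superset in \<open>AP M\<close> is pulled back along \<open>Emb T\<close>
  to a consistent set in \<open>S\<close> that contains \<open>Ext S T a\<close>, and maximality of
  the latter decides.\<close>

lemma Ext_internal_maximal:
  assumes a: "a \<in> Carr T"
  shows "Ext (AP M) internal_target a \<in> Carr (EL D (AP M))"
proof -
  interpret I: discrete_target D "AP M" internal_target
    by unfold_locales (use index_filter factor_system_AP discrete_AP is_target_internal in auto)
  have con: "consistent_set D (AP M) (Ext (AP M) internal_target a)"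
    using I.consistent_set_Ext a by simp
  have "\<beta> \<subseteq> Ext (AP M) internal_target a"
    if \<beta>: "consistent_set D (AP M) \<beta>" and sub: "Ext (AP M) internal_target a \<subseteq> \<beta>" for \<beta>
  proof -
    \<comment> \<open>All elements of \<open>\<beta>\<close> are points \<open>Emb T i x\<close>, so
      the preimage meets the same levels as \<open>\<beta>\<close> and determines it.\<close>
    define \<gamma> where "\<gamma> = {(i, x). x \<in> Lev S i \<and> (i, Emb T i x) \<in> \<beta>}"
    have "consistent_set D S \<gamma>"
      unfolding consistent_set_def
    proof (intro conjI allI impI)
      show "\<gamma> \<subseteq> Sigma UNIV (Lev S)"
        by (auto simp: \<gamma>_def)
    next
      fix i i' :: 'i and x x' assume A: "(i', x') \<in> \<gamma> \<and> (i, x) \<in> \<gamma> \<and> i \<le> i'"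
      then have "Pred (AP M) i' i (Emb T i' x') (Emb T i x)"
        using consistent_set_Pred[OF \<beta>] by (auto simp: \<gamma>_def)
      then show "Pred S i' i x' x"
        using A Pred_AP_iff by (auto simp: \<gamma>_def)
    next
      have "\<forall>\<^sub>F i in D. \<exists>b. (i, b) \<in> \<beta>"
        using \<beta> unfolding consistent_set_def by blast
      then show "\<forall>\<^sub>F i in D. \<exists>x. (i, x) \<in> \<gamma>"
      proof eventually_elim
        fix i assume "\<exists>b. (i, b) \<in> \<beta>"
        then obtain b where b: "(i, b) \<in> \<beta>" by blast
        then have "b \<in> Emb T i ` Lev S i"
          using consistent_set_Lev[OF \<beta> b] by simp
        with b show "\<exists>x. (i, x) \<in> \<gamma>"
          by (auto simp: \<gamma>_def)
      qed
    qed
    moreover have "Ext S T a \<subseteq> \<gamma>"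
      using sub by (auto simp: \<gamma>_def Ext_def Per_Emb_iff)
    ultimately have "\<gamma> = Ext S T a"
      using Ext_Carr_EL[OF a] by (simp add: EL_def max_consistent_sets_def)
    then have "Appr T a i x" if "x \<in> Lev S i" "(i, Emb T i x) \<in> \<beta>" for i x
      using that unfolding \<gamma>_def Ext_def by blast
    then show ?thesis
      using consistent_set_Lev[OF \<beta>] by (fastforce simp: Ext_def Per_Emb_iff)
  qed
  with con show ?thesis
    by (auto simp: EL_def max_consistent_sets_def)
qed

lemma pset_iso_EL_AP:
  assumes "extensional_pset M" "complete_pset D M"
  shows "pset_iso D M (pset_of_target (AP M) (EL D (AP M)))"
proof -
  interpret I: discrete_maximal_target D "AP M" internal_target
    by unfold_locales
      (use index_filter factor_system_AP discrete_AP is_target_internal Ext_internal_maximal in auto)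
  show ?thesis
    using I.pset_iso_EL assms unfolding pset_of_internal_target by simp
qed

end


theorem corollary3p25:
  fixes D :: "'i::preorder filter"
    and DD :: "('i \<times> 'i) filter"
    and S :: "('i, 'a) fsystem"
    and T :: "('i, 'a, 'm) target"
  assumes "index_filter D"
    and "index_filter DD"
    and "product_compatible D D DD"
    and "factor_system S"
    and "\<forall>i. \<forall>a\<in>Lev S i. \<forall>b\<in>Lev S i.
           (cons S i i a b \<longleftrightarrow> Pred S i i a b) \<and> (Pred S i i a b \<longleftrightarrow> a = b)"
    and "maximal_target D S T"
  shows "fs_iso S (AP (pset_of_target S T)) \<and>
         fs_iso S (AP (pset_of_target S (EL D S))) \<and>
         (extensional_pset (pset_of_target S T) \<and> complete_pset D (pset_of_target S T) \<longrightarrow>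
            is_limit TYPE('n) D S T \<and>
            pset_iso D (pset_of_target S T) (pset_of_target S (EL D S)) \<and>
            (let A = AP (pset_of_target S T)
             in pset_iso D (pset_of_target S T) (pset_of_target A (EL D A))))"
proof -
  have "is_target D S T" and "\<And>a. a \<in> Carr T \<Longrightarrow> Ext S T a \<in> Carr (EL D S)"
    using \<open>maximal_target D S T\<close> unfolding maximal_target_def by blast+
  with assms interpret discrete_maximal_target D S T
    by unfold_locales blast+
  \<comment> \<open>This instance yields the isomorphism of \<open>S\<close> with the internal
    system of \<open>EL D S\<close>.\<close>
  interpret EL: discrete_target D S "EL D S"
    by unfold_locales (rule is_target_EL)
  show ?thesis
    unfolding Let_def using fs_iso_AP EL.fs_iso_AP limit pset_iso_EL pset_iso_EL_AP by blast
qed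

end
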